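(* Let $A \subseteq \{1,3,5,\ldots\}$ and $B \subseteq \{2,4,6,\ldots\}$ be such that $1 \in A$ and $A \cup B$ is odd-ended. Define $(c_n)_{n \ge 0}$ by $$\left(1-\sum_{a \in A} \frac{x^a}{a!} + \sum_{b \in B} \frac{x^b}{b!}\right)^{-1} = \sum_{n \ge 0} c_n \frac{x^n}{n!}.$$ Then every $c_n$ is a non-negative integer, and $$c_n=\sum_{\sigma} w_\sigma,$$ where the sum is over all permutations $\sigma$ of $[n]=\{1,\ldots,n\}$ and $w_\sigma$ is the weight of $\sigma$.
   Context: The sets $A,B$ may be finite or infinite. Write $A\cup B$ as the disjoint union of its maximal intervals of consecutive integers (possibly one infinite). $A \cup B$ is odd-ended if all (finite) endpoints of these maximal intervals are odd. The maximum of a maximal interval (if it exists) is a top element; the minimum of a maximal interval is a bottom element. A number may be both. For an ordered set partition $P=P_1/\cdots/P_t$ (a sequence of disjoint nonempty blocks), its underlying permutation is obtained by writing each block in increasing order and concatenating the blocks. A singleton is a block of size 1. Freeze skip pairs of $P$ are determined by scanning $P$ from right to left, starting with $j=t$: when $P_j$ is considered, if $j\ge 2$, $P_j=\{k\}$ is a singleton, $k>\max P_{j-1}$ and $|P_{j-1}|+1\notin A\cup B$, then $(P_{j-1},P_j)$ is a freeze skip pair and the scan continues with $P_{j-2}$; otherwise the scan continues with $P_{j-1}$. For $\ell\ge 1$, the weight $w_\ell$ is the number of ordered set partitions of $\{1,\ldots,\ell\}$ with underlying permutation $12\cdots\ell$ such that: (1) every block size is either $1$ or an endpoint of a maximal interval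 of $A\cup B$; (2) every block whose size is a top element that is not a bottom element belongs to a freeze skip pair; (3) no block whose size is a bottom element that is not a top element has a singleton immediately to its right that is not in a freeze skip pair. The weight $w_\sigma$ of a permutation $\sigma$ of $[n]$ (written in one-line notation) is the product of $w_{\ell}$ over the lengths $\ell$ of all maximal increasing runs (maximal increasing strings of consecutive entries) of $\sigma$; the weight of the empty permutation is $1$. *)

theory Defs
  imports Complex_Main "HOL-Library.Disjoint_Sets"
    "HOL-Computational_Algebra.Formal_Power_Series"
    "HOL-Combinatorics.Multiset_Permutations"
begin

definition consecutive :: "nat set \<Rightarrow> bool" where
  "consecutive I \<longleftrightarrow> (\<forall>x\<in>I. \<forall>y\<in>I. {x..y} \<subseteq> I)"

definition maximal_interval :: "nat set \<Rightarrow> nat set \<Rightarrow> bool" where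
  "maximal_interval S I \<longleftrightarrow> I \<noteq> {} \<and> I \<subseteq> S \<and> consecutive I \<and>
     (\<forall>J. I \<subseteq> J \<and> J \<subseteq> S \<and> consecutive J \<longrightarrow> J = I)"

definition top_element :: "nat set \<Rightarrow> nat \<Rightarrow> bool" where
  "top_element S m \<longleftrightarrow> (\<exists>I. maximal_interval S I \<and> m \<in> I \<and> (\<forall>x\<in>I. x \<le> m))"

definition bottom_element :: "nat set \<Rightarrow> nat \<Rightarrow> bool" where
  "bottom_element S m \<longleftrightarrow> (\<exists>I. maximal_interval S I \<and> m \<in> I \<and> (\<forall>x\<in>I. m \<le> x))"

definition interval_endpoint :: "nat set \<Rightarrow> nat \<Rightarrow> bool" where
  "interval_endpoint S m \<longleftrightarrow> top_element S m \<or> bottom_element S m"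

definition odd_ended :: "nat set \<Rightarrow> bool" where
  "odd_ended S \<longleftrightarrow> (\<forall>m. interval_endpoint S m \<longrightarrow> odd m)"

definition ordered_set_partition :: "nat set \<Rightarrow> nat set list \<Rightarrow> bool" where
  "ordered_set_partition X P \<longleftrightarrow> distinct P \<and> partition_on X (set P)"

definition underlying_permutation :: "nat set list \<Rightarrow> nat list" where
  "underlying_permutation P = concat (map sorted_list_of_set P)"

(* The numeric argument is the 1-based index j of the block under consideration, whereas lists
   are 0-based: for j = Suc (Suc i), the blocks P_{j-1} and P_j are P ! i and P ! Suc i. *)
fun freeze_scan :: "nat set \<Rightarrow> nat set list \<Rightarrow> nat \<Rightarrow> (nat set \<times> nat set) set" where
  "freeze_scan S P 0 = {}"
| "freeze_scan S P (Suc 0) = {}"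
| "freeze_scan S P (Suc (Suc i)) =
     (if (\<exists>k. P ! Suc i = {k} \<and> k > Max (P ! i)) \<and> card (P ! i) + 1 \<notin> S
      then insert (P ! i, P ! Suc i) (freeze_scan S P i)
      else freeze_scan S P (Suc i))"

definition freeze_skip_pairs :: "nat set \<Rightarrow> nat set list \<Rightarrow> (nat set \<times> nat set) set" where
  "freeze_skip_pairs S P = freeze_scan S P (length P)"

(* Blocks of an ordered set partition are pairwise distinct, so a block may be identified
   with its position. *)
definition in_freeze_skip_pair :: "nat set \<Rightarrow> nat set list \<Rightarrow> nat set \<Rightarrow> bool" where
  "in_freeze_skip_pair S P X \<longleftrightarrow> (\<exists>(Y, Z) \<in> freeze_skip_pairs S P. X = Y \<or> X = Z)"

definition weighted_partitions :: "nat set \<Rightarrow> nat \<Rightarrow> nat set list set" where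
  "weighted_partitions S l = {P.
     ordered_set_partition {1..l} P \<and>
     underlying_permutation P = [1..<Suc l] \<and>
     (\<forall>X\<in>set P. card X = 1 \<or> interval_endpoint S (card X)) \<and>
     (\<forall>X\<in>set P. top_element S (card X) \<and> \<not> bottom_element S (card X)
        \<longrightarrow> in_freeze_skip_pair S P X) \<and>
     \<not> (\<exists>i. Suc i < length P \<and>
          bottom_element S (card (P ! i)) \<and> \<not> top_element S (card (P ! i)) \<and>
          card (P ! Suc i) = 1 \<and> \<not> in_freeze_skip_pair S P (P ! Suc i))}"

definition run_weight :: "nat set \<Rightarrow> nat \<Rightarrow> nat" where
  "run_weight S l = card (weighted_partitions S l)"

(* The pair (i, j) stands for the nonempty string of the entries at the 0-based
   positions i, ..., j - 1. *)
definition increasing_string :: "nat list \<Rightarrow> nat \<Rightarrow> nat \<Rightarrow> bool" where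
  "increasing_string xs i j \<longleftrightarrow>
     i < j \<and> j \<le> length xs \<and> sorted_wrt (<) (drop i (take j xs))"

definition maximal_runs :: "nat list \<Rightarrow> (nat \<times> nat) set" where
  "maximal_runs xs = {(i, j). increasing_string xs i j \<and>
     (\<forall>i' j'. i' \<le> i \<and> j \<le> j' \<and> increasing_string xs i' j' \<longrightarrow> i' = i \<and> j' = j)}"

definition perm_weight :: "nat set \<Rightarrow> nat list \<Rightarrow> nat" where
  "perm_weight S xs = (\<Prod>(i, j)\<in>maximal_runs xs. run_weight S (j - i))"

definition set_egf :: "nat set \<Rightarrow> real fps" where
  "set_egf X = Abs_fps (\<lambda>n. if n \<in> X then 1 / fact n else 0)"

end

theory Submission
  imports Defs
begin

text \<open>
  Two generating function identities are combined, with \<open>e k = 1\<close> for \<open>k \<in> A\<close>, \<open>e k = - 1\<close> for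
  \<open>k \<in> B\<close> and \<open>e k = 0\<close> otherwise. First, a freeze skip pair in a partition counted by \<open>w l\<close> is
  always a block whose size is a top element followed by a singleton, and a block of size at least 2
  outside such pairs has a bottom element as its size; the only unpaired singleton possible is the
  very first block. Hence, with \<open>U\<close> summing \<open>z^p\<close> over the bottom elements \<open>p \<noteq> 1\<close> and
  \<open>z^(q + 1)\<close> over the top elements \<open>q\<close>, we get \<open>W (1 - U) = 1 + z\<close>. As all endpoints are odd,
  \<open>1 - U = (1 + z) (1 - E)\<close> by telescoping, so \<open>W (1 - E) = 1\<close>. Secondly, this identity
  turns into a recursion for the sum of the weights of all permutations of a finite set: expanding
  the weight of the first run of a permutation amounts to choosing an increasing prefix of length
  \<open>k\<close> with coefficient \<open>e k\<close> and an arbitrary permutation of the remaining elements. The recursion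
  is the one that the inverse of the exponential generating function of \<open>1 - E\<close> satisfies.
\<close>

unbundle fps_syntax

subsection \<open>Endpoints of maximal intervals\<close>

text \<open>A maximal interval with maximum \<open>m\<close> could be enlarged by
  \<open>Suc m\<close> if that lay in \<open>S\<close>. Conversely, the numbers from which one can
  walk up to \<open>m\<close> inside \<open>S\<close> form the required maximal interval. Later
  arguments use only this local criterion.\<close>

lemma top_element_iff: "top_element S m \<longleftrightarrow> m \<in> S \<and> Suc m \<notin> S"
proof
  assume "top_element S m"
  then obtain I where I: "maximal_interval S I" "m \<in> I" "\<forall>x\<in>I. x \<le> m"
    by (auto simp: top_element_def)
  have "Suc m \<notin> S"
  proof
    assume "Suc m \<in> S"
    moreover have "consecutive (insert (Suc m) I)"
      unfolding consecutive_def
    proof (intro ballI subsetI)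
      fix x y z assume xyz: "x \<in> insert (Suc m) I" "y \<in> insert (Suc m) I" "z \<in> {x..y}"
      show "z \<in> insert (Suc m) I"
      proof (cases "m < z")
        case True
        then have "z = Suc m" using xyz I(3) by force
        then show ?thesis by simp
      next
        case False
        then have "x \<in> I" "z \<in> {x..m}" using xyz by auto
        then show ?thesis using I unfolding maximal_interval_def consecutive_def by blast
      qed
    qed
    ultimately have "insert (Suc m) I = I"
      using I unfolding maximal_interval_def by blast
    with I(3) have "Suc m \<le> m" by blast
    then show False by simp
  qed
  with I show "m \<in> S \<and> Suc m \<notin> S"
    by (auto simp: maximal_interval_def)
next
  assume m: "m \<in> S \<and> Suc m \<notin> S"
  define I where "I = {x. x \<le> m \<and> {x..m} \<subseteq> S}"
  have "J = I" if J: "I \<subseteq> J" "J \<subseteq> S" "consecutive J" for J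
  proof -
    have mJ: "m \<in> J" using J(1) m by (auto simp: I_def)
    have "x \<in> I" if "x \<in> J" for x
    proof (cases "x \<le> m")
      case True
      then show ?thesis using J that mJ unfolding consecutive_def I_def by blast
    next
      case False
      then have "Suc m \<in> {m..x}" by auto
      then show ?thesis using J that mJ m unfolding consecutive_def by blast
    qed
    with J show ?thesis by blast
  qed
  moreover have "consecutive I" "m \<in> I" "I \<subseteq> S"
    using m unfolding consecutive_def I_def by (auto simp: subset_iff)
  ultimately have "maximal_interval S I" "m \<in> I"
    unfolding maximal_interval_def by auto
  then show "top_element S m"
    unfolding top_element_def by (intro exI[of _ I]) (auto simp: I_def)
qed

text \<open>Mirror image of the previous argument. The case \<open>m = 0\<close> stands apart
  because truncated subtraction makes \<open>0 - 1\<close> equal to \<open>0\<close>.\<close>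

lemma bottom_element_iff: "bottom_element S m \<longleftrightarrow> m \<in> S \<and> (m = 0 \<or> m - 1 \<notin> S)"
proof
  assume "bottom_element S m"
  then obtain I where I: "maximal_interval S I" "m \<in> I" "\<forall>x\<in>I. m \<le> x"
    by (auto simp: bottom_element_def)
  have "m - 1 \<notin> S" if "m \<noteq> 0"
  proof
    assume "m - 1 \<in> S"
    moreover have "consecutive (insert (m - 1) I)"
      unfolding consecutive_def
    proof (intro ballI subsetI)
      fix x y z assume xyz: "x \<in> insert (m - 1) I" "y \<in> insert (m - 1) I" "z \<in> {x..y}"
      show "z \<in> insert (m - 1) I"
      proof (cases "z < m")
        case True
        then have "z = m - 1" using xyz I(3) by force
        then show ?thesis by simp
      next
        case False
        then have "y \<in> I" "z \<in> {m..y}" using xyz that by auto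
        then show ?thesis using I unfolding maximal_interval_def consecutive_def by blast
      qed
    qed
    ultimately have "insert (m - 1) I = I"
      using I unfolding maximal_interval_def by blast
    with I(3) have "m \<le> m - 1" by blast
    with that show False by simp
  qed
  with I show "m \<in> S \<and> (m = 0 \<or> m - 1 \<notin> S)"
    by (auto simp: maximal_interval_def)
next
  assume m: "m \<in> S \<and> (m = 0 \<or> m - 1 \<notin> S)"
  define I where "I = {x. m \<le> x \<and> {m..x} \<subseteq> S}"
  have "J = I" if J: "I \<subseteq> J" "J \<subseteq> S" "consecutive J" for J
  proof -
    have mJ: "m \<in> J" using J(1) m by (auto simp: I_def)
    have "x \<in> I" if "x \<in> J" for x
    proof (cases "m \<le> x")
      case True
      then show ?thesis using J that mJ unfolding consecutive_def I_def by blast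
    next
      case False
      then have "m - 1 \<in> {x..m}" "m \<noteq> 0" by auto
      then show ?thesis using J that mJ m unfolding consecutive_def by blast
    qed
    with J show ?thesis by blast
  qed
  moreover have "consecutive I" "m \<in> I" "I \<subseteq> S"
    using m unfolding consecutive_def I_def by (auto simp: subset_iff)
  ultimately have "maximal_interval S I" "m \<in> I"
    unfolding maximal_interval_def by auto
  then show "bottom_element S m"
    unfolding bottom_element_def by (intro exI[of _ I]) (auto simp: I_def)
qed

subsection \<open>The structure of weighted partitions\<close>

text \<open>Covering, disjointness and distinctness of the blocks are left out: they follow from the
  underlying permutation being \<open>[1..<Suc l]\<close>. What remains is easy to split at the last
  block.\<close>

definition interval_partition :: "nat \<Rightarrow> nat set list \<Rightarrow> bool" where
  "interval_partition l P \<longleftrightarrow>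
     (\<forall>X\<in>set P. finite X \<and> X \<noteq> {}) \<and> underlying_permutation P = [1..<Suc l]"

lemma set_underlying_permutation:
  "\<forall>X\<in>set P. finite X \<Longrightarrow> set (underlying_permutation P) = \<Union>(set P)"
  by (simp add: underlying_permutation_def)

lemma interval_partition_iff:
  "interval_partition l P \<longleftrightarrow>
     ordered_set_partition {1..l} P \<and> underlying_permutation P = [1..<Suc l]"
proof
  assume P: "interval_partition l P"
  then have fin: "\<forall>X\<in>set P. finite X" and ne: "{} \<notin> set P"
    and up: "underlying_permutation P = [1..<Suc l]"
    by (auto simp: interval_partition_def)
  have U: "\<Union>(set P) = {1..l}"
    using set_underlying_permutation[OF fin] up by auto
  have "distinct (concat (map sorted_list_of_set P))"
    using up by (simp add: underlying_permutation_def)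
  \<comment> \<open>Distinctness of a concatenation controls only the nonempty lists, so first no
    block may contribute an empty one.\<close>
  moreover have "removeAll [] (map sorted_list_of_set P) = map sorted_list_of_set P"
    using fin ne by (intro removeAll_id) (metis imageE image_set sorted_list_of_set_eq_Nil_iff)
  ultimately have d: "distinct (map sorted_list_of_set P)"
    and disj: "\<And>ys zs. ys \<in> set (map sorted_list_of_set P) \<Longrightarrow>
       zs \<in> set (map sorted_list_of_set P) \<Longrightarrow> ys \<noteq> zs \<Longrightarrow> set ys \<inter> set zs = {}"
    by (auto simp only: distinct_concat_iff)
  have "disjoint (set P)"
  proof (rule disjointI)
    fix X Y assume XY: "X \<in> set P" "Y \<in> set P" "X \<noteq> Y"
    then have "sorted_list_of_set X \<noteq> sorted_list_of_set Y"
      using fin by (metis set_sorted_list_of_set)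
    then show "X \<inter> Y = {}"
      using disj[of "sorted_list_of_set X" "sorted_list_of_set Y"] XY fin by simp
  qed
  with U ne d up show "ordered_set_partition {1..l} P \<and> underlying_permutation P = [1..<Suc l]"
    by (auto simp: ordered_set_partition_def partition_on_def distinct_map)
next
  assume P: "ordered_set_partition {1..l} P \<and> underlying_permutation P = [1..<Suc l]"
  then have "\<Union>(set P) = {1..l}" "{} \<notin> set P"
    by (auto simp: ordered_set_partition_def partition_on_def)
  then have "\<forall>X\<in>set P. finite X \<and> X \<noteq> {}"
    by (metis Union_upper finite_atLeastAtMost finite_subset)
  with P show "interval_partition l P"
    by (simp add: interval_partition_def)
qed

lemma interval_partition_Union: "interval_partition l P \<Longrightarrow> \<Union>(set P) = {1..l}"
  by (simp add: interval_partition_iff ordered_set_partition_def partition_on_def)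

lemma interval_partition_Nil [simp]: "interval_partition l [] \<longleftrightarrow> l = 0"
  by (auto simp: interval_partition_def underlying_permutation_def)

text \<open>Blocks are cut off at the right end, the direction of the freeze scan. The length of the
  underlying permutation of \<open>P\<close> determines where the last block starts.\<close>

lemma interval_partition_snoc:
  "interval_partition l (P @ [X]) \<longleftrightarrow> (\<exists>l'<l. X = {Suc l'..l} \<and> interval_partition l' P)"
proof
  assume P: "interval_partition l (P @ [X])"
  then have fin: "finite X" and ne: "X \<noteq> {}"
    and eq: "underlying_permutation P @ sorted_list_of_set X = [1..<Suc l]"
    by (auto simp: interval_partition_def underlying_permutation_def)
  define l' where "l' = length (underlying_permutation P)"
  have up: "underlying_permutation P = take l' [1..<Suc l]"
    and sx: "sorted_list_of_set X = drop l' [1..<Suc l]"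
    using eq by (metis append_eq_conv_conj l'_def)+
  have "l = l' + card X"
    using arg_cong[OF eq, of length] by (simp add: l'_def)
  then have "l' < l" using fin ne by (simp add: card_gt_0_iff)
  moreover have "X = {Suc l'..l}"
    using arg_cong[OF sx, of set] fin by (auto simp del: upt_Suc simp: drop_upt)
  moreover have "interval_partition l' P"
    using P up \<open>l' < l\<close> by (simp add: interval_partition_def take_upt del: upt_Suc)
  ultimately show "\<exists>l'<l. X = {Suc l'..l} \<and> interval_partition l' P" by blast
next
  assume "\<exists>l'<l. X = {Suc l'..l} \<and> interval_partition l' P"
  then obtain l' where l': "l' < l" "X = {Suc l'..l}" "interval_partition l' P" by blast
  moreover have "sorted_list_of_set {Suc l'..l} = [Suc l'..<Suc l]"
    by (metis atLeastLessThanSuc_atLeastAtMost sorted_list_of_set_range)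
  moreover have "[1..<Suc l'] @ [Suc l'..<Suc l] = [1..<Suc l]"
    using l' upt_add_eq_append[of 1 "Suc l'" "l - l'"] by (simp del: upt_Suc)
  ultimately show "interval_partition l (P @ [X])"
    by (auto simp: interval_partition_def underlying_permutation_def simp del: upt_Suc)
qed

section \<open>Freeze skip pairs when blocks are appended\<close>

lemma freeze_scan_append:
  "n \<le> length P \<Longrightarrow> freeze_scan S (P @ Q) n = freeze_scan S P n"
  by (induction S P n rule: freeze_scan.induct) (auto simp: nth_append)

lemma freeze_scan_subset:
  "n \<le> length P \<Longrightarrow> freeze_scan S P n \<subseteq> set P \<times> set P"
  by (induction S P n rule: freeze_scan.induct) (auto split: if_splits)

lemma freeze_skip_pairs_subset: "freeze_skip_pairs S P \<subseteq> set P \<times> set P"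
  by (simp add: freeze_skip_pairs_def freeze_scan_subset)

lemma in_freeze_skip_pair_imp: "in_freeze_skip_pair S P X \<Longrightarrow> X \<in> set P"
  using freeze_skip_pairs_subset[of S P] by (auto simp: in_freeze_skip_pair_def)

lemma freeze_skip_pairs_snoc_large:
  assumes "card X \<noteq> 1"
  shows "freeze_skip_pairs S (P @ [X]) = freeze_skip_pairs S P"
proof (cases "length P")
  case (Suc n)
  have "P ! n \<in> set P" using Suc by simp
  have "freeze_skip_pairs S (P @ [X]) = freeze_scan S (P @ [X]) (Suc (Suc n))"
    by (simp add: freeze_skip_pairs_def Suc)
  also have "\<dots> = freeze_scan S (P @ [X]) (Suc n)"
    using assms Suc by (auto simp: nth_append)
  also have "\<dots> = freeze_skip_pairs S P"
    using freeze_scan_append[of "Suc n" P S "[X]"] Suc by (simp add: freeze_skip_pairs_def)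
  finally show ?thesis .
qed (simp add: freeze_skip_pairs_def)

text \<open>If the last two blocks form a pair, the scan jumps over \<open>Y\<close> and sees only
  \<open>P\<close>; otherwise \<open>Y\<close> is the next block to be considered.\<close>

lemma freeze_skip_pairs_snoc_singleton:
  "freeze_skip_pairs S (P @ [Y, {k}]) =
     (if Max Y < k \<and> Suc (card Y) \<notin> S then insert (Y, {k}) (freeze_skip_pairs S P)
      else freeze_skip_pairs S (P @ [Y]))"
  using freeze_scan_append[of "length P" P S "[Y, {k}]"]
    freeze_scan_append[of "Suc (length P)" "P @ [Y]" S "[{k}]"]
  by (auto simp: freeze_skip_pairs_def nth_append)

text \<open>Conditions (1) to (3) separated from the partition property. Condition (3) uses
  \<open>successively\<close> instead of indices since this splits over appended lists.\<close>

definition admissible :: "nat set \<Rightarrow> nat set list \<Rightarrow> bool" where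
  "admissible S P \<longleftrightarrow>
     (\<forall>X\<in>set P. card X = 1 \<or> interval_endpoint S (card X)) \<and>
     (\<forall>X\<in>set P. top_element S (card X) \<and> \<not> bottom_element S (card X)
        \<longrightarrow> in_freeze_skip_pair S P X) \<and>
     successively (\<lambda>X Y. bottom_element S (card X) \<and> \<not> top_element S (card X) \<and> card Y = 1
        \<longrightarrow> in_freeze_skip_pair S P Y) P"

lemma weighted_partitions_eq:
  "weighted_partitions S l = {P. interval_partition l P \<and> admissible S P}"
  by (auto simp: weighted_partitions_def interval_partition_iff admissible_def
      successively_conv_nth)

lemma admissible_Nil [simp]: "admissible S []"
  by (simp add: admissible_def)

lemma successively_cong_set:
  assumes "\<And>x y. x \<in> set xs \<Longrightarrow> y \<in> set xs \<Longrightarrow> P x y \<longleftrightarrow> Q x y"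
  shows "successively P xs \<longleftrightarrow> successively Q xs"
  using assms by (simp add: successively_conv_nth)

text \<open>A last block that is not a singleton belongs to no pair and leaves the other pairs
  alone. By (1) its size is an endpoint, and by (2) a top element only if also a bottom
  element.\<close>

lemma admissible_snoc_large:
  assumes "card X \<noteq> 1" "X \<notin> set P"
  shows "admissible S (P @ [X]) \<longleftrightarrow> admissible S P \<and> bottom_element S (card X)"
proof -
  have *: "in_freeze_skip_pair S (P @ [X]) Y \<longleftrightarrow> in_freeze_skip_pair S P Y" for Y
    using assms by (simp add: in_freeze_skip_pair_def freeze_skip_pairs_snoc_large)
  have "\<not> in_freeze_skip_pair S P X"
    using assms in_freeze_skip_pair_imp by blast
  then show ?thesis
    using assms unfolding admissible_def *
    by (auto simp: successively_append_iff interval_endpoint_def)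
qed

text \<open>If \<open>Suc (card Y)\<close> is outside \<open>S\<close>, the last two blocks are a
  pair, and a size of \<open>Y\<close> allowed by (1) lies in \<open>S\<close> and is thus a top
  element. If it is in \<open>S\<close>, the singleton stays unpaired behind a block whose size
  could only be a bottom element that is not a top element.\<close>

lemma admissible_snoc_singleton:
  assumes "1 \<in> S" "0 \<notin> S"
    and "Max Y < k" "Y \<notin> set P" "{k} \<notin> set P" "Y \<noteq> {k}"
  shows "admissible S (P @ [Y, {k}]) \<longleftrightarrow> admissible S P \<and> top_element S (card Y)"
proof (cases "Suc (card Y) \<in> S")
  case False
  have pairs: "freeze_skip_pairs S (P @ [Y, {k}]) = insert (Y, {k}) (freeze_skip_pairs S P)"
    using assms False by (simp add: freeze_skip_pairs_snoc_singleton)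
  have in_old: "in_freeze_skip_pair S (P @ [Y, {k}]) Z \<longleftrightarrow> in_freeze_skip_pair S P Z"
    if "Z \<in> set P" for Z
    using that assms unfolding in_freeze_skip_pair_def pairs by auto
  have in_new: "in_freeze_skip_pair S (P @ [Y, {k}]) Y" "in_freeze_skip_pair S (P @ [Y, {k}]) {k}"
    unfolding in_freeze_skip_pair_def pairs by auto
  have one: "bottom_element S 1"
    using assms by (simp add: bottom_element_iff)
  have "successively (\<lambda>X Z. bottom_element S (card X) \<and> \<not> top_element S (card X) \<and> card Z = 1
        \<longrightarrow> in_freeze_skip_pair S (P @ [Y, {k}]) Z) P \<longleftrightarrow>
     successively (\<lambda>X Z. bottom_element S (card X) \<and> \<not> top_element S (card X) \<and> card Z = 1
        \<longrightarrow> in_freeze_skip_pair S P Z) P"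
    by (rule successively_cong_set) (simp add: in_old)
  moreover have "card Y = 1 \<or> interval_endpoint S (card Y) \<longleftrightarrow> top_element S (card Y)"
    using False assms
    by (auto simp: interval_endpoint_def top_element_iff bottom_element_iff)
  ultimately show ?thesis
    using in_new in_old one unfolding admissible_def
    by (auto simp: successively_append_iff)
next
  case True
  have "freeze_skip_pairs S (P @ [Y, {k}]) = freeze_skip_pairs S (P @ [Y])"
    using assms True by (simp add: freeze_skip_pairs_snoc_singleton)
  then have nin: "\<not> in_freeze_skip_pair S (P @ [Y, {k}]) {k}"
    using in_freeze_skip_pair_imp[of S "P @ [Y]" "{k}"] assms
    by (auto simp: in_freeze_skip_pair_def)
  \<comment> \<open>The size of \<open>Y\<close> would have to be a bottom element that is not a top element, contrary to (3).\<close>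
  have "\<not> admissible S (P @ [Y, {k}])"
  proof
    assume "admissible S (P @ [Y, {k}])"
    with nin have "card Y = 1 \<or> interval_endpoint S (card Y)"
      and "\<not> (bottom_element S (card Y) \<and> \<not> top_element S (card Y))"
      by (auto simp: admissible_def successively_append_iff)
    then show False
      using True assms
      by (auto simp: interval_endpoint_def top_element_iff bottom_element_iff)
  qed
  then show ?thesis using True by (simp add: top_element_iff)
qed

section \<open>Recursion for the run weights\<close>

lemma interval_partition_snoc_interval:
  assumes "m < l"
  shows "interval_partition l (P @ [{Suc m..l}]) \<longleftrightarrow> interval_partition m P"
proof -
  have "{Suc m..l} = {Suc l'..l} \<longleftrightarrow> m = l'" if "l' < l" for l'
    using assms that by (auto simp: Icc_eq_Icc)
  then show ?thesis
    using assms unfolding interval_partition_snoc by blast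
qed

lemma weighted_partitions_snoc_large:
  assumes "2 \<le> p" "p \<le> l"
  shows "P @ [{Suc (l - p)..l}] \<in> weighted_partitions S l \<longleftrightarrow>
    P \<in> weighted_partitions S (l - p) \<and> bottom_element S p"
proof -
  have "interval_partition l (P @ [{Suc (l - p)..l}]) \<longleftrightarrow> interval_partition (l - p) P"
    using assms by (simp add: interval_partition_snoc_interval)
  moreover have "admissible S (P @ [{Suc (l - p)..l}]) \<longleftrightarrow> admissible S P \<and> bottom_element S p"
    if "interval_partition (l - p) P"
  proof -
    have "{Suc (l - p)..l} \<notin> set P"
    proof
      assume "{Suc (l - p)..l} \<in> set P"
      moreover have "l \<in> {Suc (l - p)..l}" using assms by auto
      ultimately have "l \<in> {1..l - p}" using interval_partition_Union[OF that] by blast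
      with assms show False by auto
    qed
    then show ?thesis using assms by (simp add: admissible_snoc_large)
  qed
  ultimately show ?thesis by (auto simp: weighted_partitions_eq)
qed

text \<open>Here \<open>k\<close> is the total size of the last two blocks; the singleton takes one
  element, so the block before it has size \<open>k - 1\<close>.\<close>

lemma weighted_partitions_snoc_pair:
  assumes S: "1 \<in> S" "0 \<notin> S" and k: "2 \<le> k" "k \<le> l"
  shows "P @ [{Suc (l - k)..l - 1}, {l}] \<in> weighted_partitions S l \<longleftrightarrow>
    P \<in> weighted_partitions S (l - k) \<and> top_element S (k - 1)"
proof -
  let ?Y = "{Suc (l - k)..l - 1}"
  have last: "{l} = {Suc (l - 1)..l}" using k by auto
  have "interval_partition l ((P @ [?Y]) @ [{l}]) \<longleftrightarrow> interval_partition (l - 1) (P @ [?Y])"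
    unfolding last using k by (intro interval_partition_snoc_interval) auto
  also have "\<dots> \<longleftrightarrow> interval_partition (l - k) P"
    using k by (intro interval_partition_snoc_interval) auto
  finally have ip: "interval_partition l (P @ [?Y, {l}]) \<longleftrightarrow> interval_partition (l - k) P"
    by simp
  have "admissible S (P @ [?Y, {l}]) \<longleftrightarrow> admissible S P \<and> top_element S (k - 1)"
    if "interval_partition (l - k) P"
  proof -
    have sub: "X \<subseteq> {1..l - k}" if "X \<in> set P" for X
      using interval_partition_Union[OF \<open>interval_partition (l - k) P\<close>] that by blast
    have Y: "l - 1 \<in> ?Y" using k by auto
    have "?Y \<notin> set P" "{l} \<notin> set P" "?Y \<noteq> {l}"
      using sub[of ?Y] sub[of "{l}"] Y k by auto
    moreover have "Max ?Y < l" using Y k by (subst Max_less_iff) auto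
    moreover have "card ?Y = k - 1" using k by simp
    ultimately show ?thesis
      using S by (simp add: admissible_snoc_singleton)
  qed
  with ip show ?thesis by (auto simp: weighted_partitions_eq)
qed

lemma finite_weighted_partitions: "finite (weighted_partitions S l)"
proof (rule finite_subset)
  show "weighted_partitions S l \<subseteq> {P. set P \<subseteq> Pow {1..l} \<and> distinct P}"
    by (auto simp: weighted_partitions_def ordered_set_partition_def partition_on_def)
  show "finite {P. set P \<subseteq> Pow {1..l} \<and> distinct P}"
    by (rule finite_subset_distinct) simp
qed

text \<open>The last block is either large or a singleton. As \<open>l\<close> is at least 2, a
  singleton has a predecessor, and the two blocks are removed together.\<close>

lemma weighted_partitions_rec:
  assumes S: "1 \<in> S" "0 \<notin> S" and l: "2 \<le> l"
  shows "weighted_partitions S l =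
    (\<Union>p\<in>{p. 2 \<le> p \<and> p \<le> l \<and> bottom_element S p}.
       (\<lambda>P. P @ [{Suc (l - p)..l}]) ` weighted_partitions S (l - p)) \<union>
    (\<Union>k\<in>{k. 2 \<le> k \<and> k \<le> l \<and> top_element S (k - 1)}.
       (\<lambda>P. P @ [{Suc (l - k)..l - 1}, {l}]) ` weighted_partitions S (l - k))"
    (is "_ = ?R")
proof
  show "?R \<subseteq> weighted_partitions S l"
    using weighted_partitions_snoc_large[of _ l] weighted_partitions_snoc_pair[OF S, of _ l] by auto
  show "weighted_partitions S l \<subseteq> ?R"
  proof
    fix P assume P: "P \<in> weighted_partitions S l"
    then have ip: "interval_partition l P" by (simp add: weighted_partitions_eq)
    with l obtain P' X where PX: "P = P' @ [X]" by (cases P rule: rev_cases) auto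
    with ip obtain l' where l': "l' < l" "X = {Suc l'..l}" "interval_partition l' P'"
      by (auto simp: interval_partition_snoc)
    show "P \<in> ?R"
    proof (cases "Suc l' = l")
      case False
      define p where "p = l - l'"
      with False l' have p: "2 \<le> p" "p \<le> l" "l' = l - p" by auto
      then have "P' \<in> weighted_partitions S (l - p)" "bottom_element S p"
        using P PX l' weighted_partitions_snoc_large[of p l P' S] by auto
      then show ?thesis using PX l' p by blast
    next
      case True
      with l l' obtain P'' Y where PY: "P' = P'' @ [Y]" by (cases P' rule: rev_cases) auto
      with l' obtain l'' where l'': "l'' < l'" "Y = {Suc l''..l'}"
        by (auto simp: interval_partition_snoc)
      define k where "k = l - l''"
      have k: "2 \<le> k" "k \<le> l" "l'' = l - k" "l' = l - 1" "X = {l}"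
        using True l' l'' by (auto simp: k_def)
      then have eq: "P = P'' @ [{Suc (l - k)..l - 1}, {l}]" using PX PY l'' by simp
      then have "P'' \<in> weighted_partitions S (l - k)" "top_element S (k - 1)"
        using P k weighted_partitions_snoc_pair[OF S, of k l P''] by auto
      then show ?thesis using eq k by blast
    qed
  qed
qed

lemma run_weight_rec:
  assumes S: "1 \<in> S" "0 \<notin> S" and l: "2 \<le> l"
  shows "run_weight S l =
    (\<Sum>p | 2 \<le> p \<and> p \<le> l \<and> bottom_element S p. run_weight S (l - p)) +
    (\<Sum>k | 2 \<le> k \<and> k \<le> l \<and> top_element S (k - 1). run_weight S (l - k))"
proof -
  let ?I = "{p. 2 \<le> p \<and> p \<le> l \<and> bottom_element S p}"
  let ?J = "{k. 2 \<le> k \<and> k \<le> l \<and> top_element S (k - 1)}"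
  let ?A = "\<lambda>p. (\<lambda>P. P @ [{Suc (l - p)..l}]) ` weighted_partitions S (l - p)"
  let ?B = "\<lambda>k. (\<lambda>P. P @ [{Suc (l - k)..l - 1}, {l}]) ` weighted_partitions S (l - k)"
  have fin: "finite ?I" "finite ?J" by (auto intro: finite_subset[of _ "{..l}"])
  \<comment> \<open>All unions are disjoint: the size of the last block tells the two kinds apart
    and recovers \<open>p\<close>, and the size of the block before a final singleton recovers
    \<open>k\<close>.\<close>
  have A: "card (last P) = p" if "p \<in> ?I" "P \<in> ?A p" for p P
    using that by auto
  have B: "card (last P) = 1" "card (last (butlast P)) = k - 1" if "k \<in> ?J" "P \<in> ?B k" for k P
    using that by (auto simp: butlast_append)
  have "(\<Union>p\<in>?I. ?A p) \<inter> (\<Union>k\<in>?J. ?B k) = {}"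
  proof (rule equals0I)
    fix P assume "P \<in> (\<Union>p\<in>?I. ?A p) \<inter> (\<Union>k\<in>?J. ?B k)"
    then obtain p k where "p \<in> ?I" "P \<in> ?A p" "k \<in> ?J" "P \<in> ?B k" by blast
    with A[of p P] B(1)[of k P] show False by simp
  qed
  then have "run_weight S l = card (\<Union>p\<in>?I. ?A p) + card (\<Union>k\<in>?J. ?B k)"
    unfolding run_weight_def weighted_partitions_rec[OF assms]
    using fin finite_weighted_partitions by (intro card_Un_disjoint) auto
  also have "card (\<Union>p\<in>?I. ?A p) = (\<Sum>p\<in>?I. card (?A p))"
  proof (rule card_UN_disjoint)
    show "\<forall>i\<in>?I. \<forall>j\<in>?I. i \<noteq> j \<longrightarrow> ?A i \<inter> ?A j = {}"
    proof (intro ballI impI equals0I)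
      fix i j P assume ij: "i \<in> ?I" "j \<in> ?I" "i \<noteq> j" "P \<in> ?A i \<inter> ?A j"
      show False
        using A[OF ij(1) IntD1[OF ij(4)]] A[OF ij(2) IntD2[OF ij(4)]] ij(3) by simp
    qed
  qed (use fin finite_weighted_partitions in auto)
  also have "(\<Sum>p\<in>?I. card (?A p)) = (\<Sum>p\<in>?I. run_weight S (l - p))"
    by (simp add: card_image inj_on_def run_weight_def)
  also have "card (\<Union>k\<in>?J. ?B k) = (\<Sum>k\<in>?J. card (?B k))"
  proof (rule card_UN_disjoint)
    show "\<forall>i\<in>?J. \<forall>j\<in>?J. i \<noteq> j \<longrightarrow> ?B i \<inter> ?B j = {}"
    proof (intro ballI impI equals0I)
      fix i j P assume ij: "i \<in> ?J" "j \<in> ?J" "i \<noteq> j" "P \<in> ?B i \<inter> ?B j"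
      have "i - 1 = j - 1"
        using B(2)[OF ij(1) IntD1[OF ij(4)]] B(2)[OF ij(2) IntD2[OF ij(4)]] by simp
      with ij show False by auto
    qed
  qed (use fin finite_weighted_partitions in auto)
  also have "(\<Sum>k\<in>?J. card (?B k)) = (\<Sum>k\<in>?J. run_weight S (l - k))"
    by (simp add: card_image inj_on_def run_weight_def)
  finally show ?thesis .
qed

lemma run_weight_0: "run_weight S 0 = 1"
proof -
  have "P = []" if "interval_partition 0 P" for P
    using that by (cases P rule: rev_cases) (auto simp: interval_partition_snoc)
  then have "weighted_partitions S 0 = {[]}"
    by (auto simp: weighted_partitions_eq)
  then show ?thesis by (simp add: run_weight_def)
qed

text \<open>The lone initial singleton is not covered by the recursion; it accounts for the term
  \<open>fps_X\<close> in \<open>1 + fps_X\<close> below.\<close>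

lemma run_weight_1:
  assumes "1 \<in> S" "0 \<notin> S"
  shows "run_weight S 1 = 1"
proof -
  have "interval_partition 1 P \<longleftrightarrow> P = [{1}]" for P
  proof (cases P rule: rev_cases)
    case (snoc P' X)
    have "interval_partition 0 P' \<longleftrightarrow> P' = []"
      by (cases P' rule: rev_cases) (auto simp: interval_partition_snoc)
    with snoc show ?thesis by (auto simp: interval_partition_snoc)
  qed auto
  moreover have "admissible S [{1}]"
    using assms by (auto simp: admissible_def bottom_element_iff)
  ultimately have "weighted_partitions S 1 = {[{1}]}"
    by (auto simp: weighted_partitions_eq)
  then show ?thesis by (simp add: run_weight_def)
qed

subsection \<open>The generating function of the run weights\<close>

text \<open>For the union of \<open>A\<close> and \<open>B\<close>, parity tells which of the two
  sets an element comes from, so this is the sign with which it enters the given series.\<close>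

definition signed_indicator :: "nat set \<Rightarrow> nat \<Rightarrow> real" where
  "signed_indicator S k = (if k \<in> S then if odd k then 1 else - 1 else 0)"

lemma run_weight_gf:
  assumes S: "1 \<in> S" "0 \<notin> S" and "odd_ended S"
  shows "(1 - Abs_fps (signed_indicator S)) * Abs_fps (\<lambda>l. real (run_weight S l)) = 1"
proof -
  let ?W = "Abs_fps (\<lambda>l. real (run_weight S l))" and ?E = "Abs_fps (signed_indicator S)"
  \<comment> \<open>The coefficient at \<open>k\<close> records the ways to remove final blocks of
    total size \<open>k\<close>: one block of bottom size \<open>k\<close>, or one of top size
    \<open>k - 1\<close> with a singleton.\<close>
  define U :: "real fps" where
    "U = Abs_fps (\<lambda>k. of_bool (2 \<le> k \<and> bottom_element S k) + of_bool (2 \<le> k \<and> top_element S (k - 1)))"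
  have ends: "odd k" if "bottom_element S k \<or> top_element S k" for k
    using that \<open>odd_ended S\<close> by (auto simp: odd_ended_def interval_endpoint_def)
  \<comment> \<open>Neighbours inside an interval have opposite signs and cancel. What survives sits
    at a bottom element or one above a top element, with sign 1 because endpoints are odd. In degree
    1 both sides vanish since 1 is in \<open>S\<close>.\<close>
  have EU: "(1 - ?E) * (1 + fps_X) = 1 - U"
  proof (rule fps_ext)
    fix n
    consider "n = 0" | "n = 1" | m where "n = Suc (Suc m)"
      by (metis One_nat_def nat.exhaust)
    then show "((1 - ?E) * (1 + fps_X)) $ n = (1 - U) $ n"
    proof cases
      case 3
      then show ?thesis
        using ends[of "Suc m"] ends[of "Suc (Suc m)"]
        by (auto simp: distrib_left U_def signed_indicator_def top_element_iff bottom_element_iff)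
    qed (use S in \<open>auto simp: distrib_left U_def signed_indicator_def\<close>)
  qed
  have UW: "(1 - U) * ?W = 1 + fps_X"
  proof (rule fps_ext)
    fix n
    have "(U * ?W) $ n = (\<Sum>k\<in>{0..n}. (of_bool (2 \<le> k \<and> bottom_element S k) +
        of_bool (2 \<le> k \<and> top_element S (k - 1))) * real (run_weight S (n - k)))"
      by (simp add: fps_mult_nth U_def)
    also have "\<dots> = (\<Sum>p | 2 \<le> p \<and> p \<le> n \<and> bottom_element S p. real (run_weight S (n - p))) +
      (\<Sum>k | 2 \<le> k \<and> k \<le> n \<and> top_element S (k - 1). real (run_weight S (n - k)))"
      unfolding distrib_right sum.distrib
      by (intro arg_cong2[where f = "(+)"] sum.mono_neutral_cong_right) auto
    finally have *: "(U * ?W) $ n = \<dots>" .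
    \<comment> \<open>\<open>U\<close> has no terms below degree 2, so there the product only shows
      the initial run weights; from degree 2 on the recursion makes it vanish.\<close>
    consider "n = 0" | "n = 1" | "2 \<le> n" by linarith
    then show "((1 - U) * ?W) $ n = (1 + fps_X) $ n"
    proof cases
      case 3
      then show ?thesis
        using * run_weight_rec[OF S 3] by (simp add: left_diff_distrib)
    qed (use run_weight_0[of S] run_weight_1[OF S] in
        \<open>auto simp: left_diff_distrib fps_mult_nth U_def\<close>)
  qed
  have "(1 + fps_X) * ((1 - ?E) * ?W) = (1 - U) * ?W"
    by (simp flip: EU add: ac_simps)
  then have "(1 + fps_X) * ((1 - ?E) * ?W) = (1 + fps_X) * 1"
    using UW by simp
  moreover have "(1 + fps_X :: real fps) \<noteq> 0"
    by (metis fps_X_nth fps_add_nth fps_one_nth fps_zero_nth add_0_right zero_neq_one)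
  ultimately show ?thesis by (rule mult_left_cancel[THEN iffD1, rotated])
qed

text \<open>Coefficient comparison in \<open>F = 1 + E * F\<close>, where the zero constant term of
  \<open>E\<close> removes \<open>F $ n\<close> from the right. It serves both the ordinary series
  of the run weights and the exponential series of \<open>c\<close>.\<close>

lemma fps_nth_rec:
  fixes E F :: "real fps"
  assumes "(1 - E) * F = 1" "E $ 0 = 0" "n > 0"
  shows "F $ n = (\<Sum>k=1..n. E $ k * F $ (n - k))"
proof -
  have "F = 1 + E * F" using assms(1) by (simp add: algebra_simps)
  then have "F $ n = (1 + E * F) $ n" by simp
  then show ?thesis
    using assms by (simp add: fps_mult_nth sum.atLeast_Suc_atMost)
qed

subsection \<open>Weights of permutations\<close>

lemma increasing_string_iff:
  "increasing_string xs i j \<longleftrightarrow>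
     i < j \<and> j \<le> length xs \<and> (\<forall>t. i \<le> t \<and> Suc t < j \<longrightarrow> xs ! t < xs ! Suc t)"
proof (cases "i < j \<and> j \<le> length xs")
  case True
  then have "increasing_string xs i j \<longleftrightarrow>
      (\<forall>t. Suc t < j - i \<longrightarrow> xs ! (i + t) < xs ! (i + Suc t))"
    by (simp add: increasing_string_def sorted_wrt_iff_nth_Suc_transp)
  also have "\<dots> \<longleftrightarrow> (\<forall>t. i \<le> t \<and> Suc t < j \<longrightarrow> xs ! t < xs ! Suc t)"
  proof (intro iffI allI impI)
    fix t assume H: "\<forall>t. Suc t < j - i \<longrightarrow> xs ! (i + t) < xs ! (i + Suc t)" "i \<le> t \<and> Suc t < j"
    then have "t = i + (t - i)" "Suc (t - i) < j - i" by auto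
    then show "xs ! t < xs ! Suc t" using H(1) by (metis add_Suc_right)
  qed auto
  finally show ?thesis using True by simp
qed (auto simp: increasing_string_def)

text \<open>No increasing string crosses the descent between \<open>xs\<close> and
  \<open>ys\<close>. Strings starting in \<open>xs\<close> therefore lie inside the run
  \<open>xs\<close>, and all others are shifted strings of \<open>ys\<close>.\<close>

lemma maximal_runs_append:
  assumes xs: "xs \<noteq> []" "sorted_wrt (<) xs" and desc: "ys = [] \<or> hd ys < last xs"
  shows "maximal_runs (xs @ ys) =
    insert (0, length xs) ((\<lambda>(i, j). (i + length xs, j + length xs)) ` maximal_runs ys)"
proof -
  let ?L = "length xs"
  have first: "increasing_string (xs @ ys) 0 ?L"
    using xs by (simp add: increasing_string_def)
  have early: "j \<le> ?L" if "increasing_string (xs @ ys) i j" "i < ?L" for i j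
  proof (rule ccontr)
    assume "\<not> j \<le> ?L"
    with that have "i \<le> ?L - 1" "Suc (?L - 1) < j" "j \<le> ?L + length ys" "Suc (?L - 1) = ?L"
      by (auto simp: increasing_string_iff)
    with that have "(xs @ ys) ! (?L - 1) < (xs @ ys) ! ?L" "ys \<noteq> []"
      by (auto simp: increasing_string_iff)
    then show False
      using desc xs by (simp add: nth_append last_conv_nth hd_conv_nth)
  qed
  have shift: "increasing_string (xs @ ys) (i + ?L) (j + ?L) \<longleftrightarrow> increasing_string ys i j" for i j
    by (simp add: increasing_string_def)
  show ?thesis
  proof (intro set_eqI iffI)
    fix p assume p: "p \<in> maximal_runs (xs @ ys)"
    obtain i j where ij: "p = (i, j)" by (cases p)
    with p have inc: "increasing_string (xs @ ys) i j"
      and mx: "\<And>i' j'. i' \<le> i \<Longrightarrow> j \<le> j' \<Longrightarrow> increasing_string (xs @ ys) i' j' \<Longrightarrow> i' = i \<and> j' = j"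
      by (auto simp: maximal_runs_def)
    show "p \<in> insert (0, ?L) ((\<lambda>(i, j). (i + ?L, j + ?L)) ` maximal_runs ys)"
    proof (cases "i < ?L")
      case True
      then show ?thesis using mx[of 0 ?L] early[OF inc] first ij by simp
    next
      case False
      then obtain i' where i': "i = i' + ?L" by (metis add.commute le_Suc_ex not_less)
      moreover have "i < j" using inc by (simp add: increasing_string_def)
      ultimately obtain j' where j': "j = j' + ?L"
        by (metis add.commute le_Suc_ex not_less order.strict_trans2 False less_imp_le_nat nat_le_linear)
      have "(i', j') \<in> maximal_runs ys"
        unfolding maximal_runs_def
      proof (clarsimp, intro conjI allI impI)
        show "increasing_string ys i' j'" using inc shift i' j' by simp
        fix i'' j'' assume "i'' \<le> i' \<and> j' \<le> j'' \<and> increasing_string ys i'' j''"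
        then show "i'' = i'" "j'' = j'"
          using mx[of "i'' + ?L" "j'' + ?L"] shift i' j' by auto
      qed
      then show ?thesis using ij i' j' by force
    qed
  next
    fix p assume "p \<in> insert (0, ?L) ((\<lambda>(i, j). (i + ?L, j + ?L)) ` maximal_runs ys)"
    then consider "p = (0, ?L)"
      | i j where "(i, j) \<in> maximal_runs ys" "p = (i + ?L, j + ?L)" by auto
    then show "p \<in> maximal_runs (xs @ ys)"
    proof cases
      case 1
      have "j = ?L" if "?L \<le> j" "increasing_string (xs @ ys) 0 j" for j
        using that early[of 0 j] xs by auto
      with 1 first show ?thesis by (auto simp: maximal_runs_def)
    next
      case 2
      then have inc: "increasing_string ys i j"
        and mx: "\<And>i' j'. i' \<le> i \<Longrightarrow> j \<le> j' \<Longrightarrow> increasing_string ys i' j' \<Longrightarrow> i' = i \<and> j' = j"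
        by (auto simp: maximal_runs_def)
      have "i' = i + ?L \<and> j' = j + ?L"
        if H: "i' \<le> i + ?L" "j + ?L \<le> j'" "increasing_string (xs @ ys) i' j'" for i' j'
      proof -
        have "i < j" using inc by (simp add: increasing_string_def)
        then have "\<not> i' < ?L" using early[OF H(3)] H by auto
        then obtain i'' where i'': "i' = i'' + ?L" by (metis add.commute le_Suc_ex not_less)
        obtain j'' where j'': "j' = j'' + ?L"
          using H(2) by (metis add.assoc add.commute le_Suc_ex)
        show ?thesis using mx[of i'' j''] H i'' j'' shift by auto
      qed
      with 2 inc shift show ?thesis by (auto simp: maximal_runs_def)
    qed
  qed
qed

lemma maximal_runs_Nil [simp]: "maximal_runs [] = {}"
  by (auto simp: maximal_runs_def increasing_string_def)

lemma finite_maximal_runs: "finite (maximal_runs xs)"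
  by (rule finite_subset[of _ "{..length xs} \<times> {..length xs}"])
    (auto simp: maximal_runs_def increasing_string_def)

lemma perm_weight_Nil [simp]: "perm_weight S [] = 1"
  by (simp add: perm_weight_def)

lemma perm_weight_append:
  assumes xs: "xs \<noteq> []" "sorted_wrt (<) xs" and desc: "ys = [] \<or> hd ys < last xs"
  shows "perm_weight S (xs @ ys) = run_weight S (length xs) * perm_weight S ys"
proof -
  let ?f = "\<lambda>(i, j). (i + length xs, j + length xs)"
  have "(0, length xs) \<notin> ?f ` maximal_runs ys"
    using xs by auto
  moreover have "inj_on ?f (maximal_runs ys)" by (auto simp: inj_on_def)
  ultimately show ?thesis
    unfolding perm_weight_def maximal_runs_append[OF assms]
    by (simp add: finite_maximal_runs prod.reindex case_prod_unfold)
qed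

text \<open>Take the longest increasing prefix. Were it not followed by a descent, distinctness
  would force an ascent there and the prefix could be extended.\<close>

lemma first_run_exists:
  assumes "xs \<noteq> []" "distinct (xs :: nat list)"
  obtains L where "0 < L" "L \<le> length xs" "sorted_wrt (<) (take L xs)"
    "drop L xs = [] \<or> hd (drop L xs) < last (take L xs)"
proof -
  let ?Q = "\<lambda>L. L \<le> length xs \<and> sorted_wrt (<) (take L xs)"
  define L where "L = Greatest ?Q"
  have "?Q 1" using assms by (cases xs) auto
  then have Q: "?Q L" and ge: "1 \<le> L"
    unfolding L_def by (rule GreatestI_nat[where b = "length xs"], simp)
      (rule Greatest_le_nat[where b = "length xs"], use \<open>?Q 1\<close> in auto)
  have desc: "drop L xs = [] \<or> hd (drop L xs) < last (take L xs)"
  proof (rule ccontr)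
    assume neg: "\<not> ?thesis"
    then have L: "L < length xs" by auto
    have lt: "last (take L xs) = xs ! (L - 1)" "hd (drop L xs) = xs ! L"
      using L ge assms by (auto simp: last_conv_nth hd_drop_conv_nth)
    have "xs ! (L - 1) \<noteq> xs ! L"
      using L ge assms by (simp add: nth_eq_iff_index_eq)
    with neg lt have asc: "last (take L xs) < xs ! L" by auto
    have "take L xs = butlast (take L xs) @ [last (take L xs)]"
      using ge assms by simp
    with Q have "\<forall>y\<in>set (take L xs). y \<le> last (take L xs)"
      by (metis (no_types, lifting) Un_iff empty_iff empty_set less_imp_le list.set_intros(1)
          order_refl set_ConsD set_append sorted_wrt_append)
    with asc have "?Q (Suc L)"
      using Q L by (auto simp: take_Suc_conv_app_nth sorted_wrt_append)
    then have "Suc L \<le> L"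
      unfolding L_def by (rule Greatest_le_nat[where b = "length xs"]) auto
    then show False by simp
  qed
  show thesis by (rule that[OF _ _ _ desc]) (use Q ge in auto)
qed

text \<open>If the first run has length \<open>L\<close>, exactly the prefixes of length at most \<open>L\<close> are increasing, and
  removing one of length \<open>k\<close> leaves a first run of length \<open>L - k\<close>.\<close>

lemma perm_weight_expand:
  fixes e :: "nat \<Rightarrow> real"
  assumes w0: "run_weight S 0 = 1"
    and w: "\<And>l. l > 0 \<Longrightarrow> real (run_weight S l) = (\<Sum>k=1..l. e k * real (run_weight S (l - k)))"
    and xs: "xs \<noteq> []" "distinct xs"
  shows "real (perm_weight S xs) =
    (\<Sum>k=1..length xs. if sorted_wrt (<) (take k xs) then e k * real (perm_weight S (drop k xs)) else 0)"
proof -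
  obtain L where L: "0 < L" "L \<le> length xs" "sorted_wrt (<) (take L xs)"
    and desc: "drop L xs = [] \<or> hd (drop L xs) < last (take L xs)"
    using first_run_exists[OF xs] by blast
  have weight: "perm_weight S (drop k xs) = run_weight S (L - k) * perm_weight S (drop L xs)"
    if "k \<le> L" for k
  proof (cases "k = L")
    case False
    with that have k: "k < L" by simp
    have "drop k xs = drop k (take L xs) @ drop L xs"
      using L that by (metis append_take_drop_id drop_append length_take min.absorb2 diff_is_0_eq drop0)
    moreover have "perm_weight S (drop k (take L xs) @ drop L xs) =
        run_weight S (length (drop k (take L xs))) * perm_weight S (drop L xs)"
      using L k desc by (intro perm_weight_append) (auto intro: sorted_wrt_drop simp: last_drop)
    ultimately show ?thesis using L by simp
  qed (simp add: w0)
  have sorted: "sorted_wrt (<) (take k xs) \<longleftrightarrow> k \<le> L" if "k \<le> length xs" for k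
  proof
    assume k: "sorted_wrt (<) (take k xs)"
    show "k \<le> L"
    proof (rule ccontr)
      assume "\<not> k \<le> L"
      then have "L < k" by simp
      then have "take k xs ! (L - 1) < take k xs ! L"
        using k that L by (intro sorted_wrt_nth_less[of "(<)"]) auto
      moreover have "last (take L xs) = xs ! (L - 1)" "hd (drop L xs) = xs ! L"
        using L \<open>L < k\<close> that xs by (auto simp: last_conv_nth hd_drop_conv_nth)
      ultimately show False using desc \<open>L < k\<close> that by auto
    qed
  next
    assume "k \<le> L"
    then show "sorted_wrt (<) (take k xs)"
      using L(3) sorted_wrt_take[of "(<)" "take L xs" k] by (simp add: min_def)
  qed
  have "(\<Sum>k=1..length xs. if sorted_wrt (<) (take k xs) then e k * real (perm_weight S (drop k xs)) else 0)
      = (\<Sum>k=1..length xs. if k \<le> L then e k * real (perm_weight S (drop k xs)) else 0)"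
    by (intro sum.cong) (auto simp: sorted)
  also have "\<dots> = (\<Sum>k=1..L. e k * real (perm_weight S (drop k xs)))"
    using L by (intro sum.mono_neutral_cong_right) auto
  \<comment> \<open>All terms share the weight of what follows the first run; the remaining factor
    is the recursion \<open>w\<close> for a run of length \<open>L\<close>.\<close>
  also have "\<dots> = (\<Sum>k=1..L. e k * real (run_weight S (L - k))) * real (perm_weight S (drop L xs))"
    unfolding sum_distrib_right by (intro sum.cong refl, subst weight) simp_all
  also have "\<dots> = real (perm_weight S (drop 0 xs))"
    using weight[of 0] by (simp only: w[OF L(1), symmetric]) simp
  finally show ?thesis by simp
qed

section \<open>Summation over all permutations of a set\<close>

lemma sum_permutations_increasing_prefix:
  fixes f :: "nat list \<Rightarrow> real"
  assumes "finite X" "k \<le> card X"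
  shows "(\<Sum>\<sigma>\<in>permutations_of_set X. if sorted_wrt (<) (take k \<sigma>) then f (drop k \<sigma>) else 0) =
    (\<Sum>T | T \<subseteq> X \<and> card T = k. \<Sum>\<tau>\<in>permutations_of_set (X - T). f \<tau>)"
proof -
  let ?A = "{T. T \<subseteq> X \<and> card T = k}"
  have fin: "finite ?A" using assms by simp
  have "(\<Sum>\<sigma>\<in>permutations_of_set X. if sorted_wrt (<) (take k \<sigma>) then f (drop k \<sigma>) else 0) =
      (\<Sum>\<sigma> | \<sigma> \<in> permutations_of_set X \<and> sorted_wrt (<) (take k \<sigma>). f (drop k \<sigma>))"
    by (simp add: sum.inter_filter)
  also have "\<dots> = (\<Sum>(T, \<tau>)\<in>Sigma ?A (\<lambda>T. permutations_of_set (X - T)). f \<tau>)"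
  \<comment> \<open>An increasing prefix is determined by its set of entries, so a permutation with
    such a prefix amounts to a \<open>k\<close>-subset and a permutation of its complement.\<close>
  proof (rule sum.reindex_bij_witness[where
        i = "\<lambda>(T, \<tau>). sorted_list_of_set T @ \<tau>" and j = "\<lambda>\<sigma>. (set (take k \<sigma>), drop k \<sigma>)"])
    fix \<sigma> assume "\<sigma> \<in> {\<sigma> \<in> permutations_of_set X. sorted_wrt (<) (take k \<sigma>)}"
    then have \<sigma>: "set \<sigma> = X" "distinct \<sigma>" "sorted_wrt (<) (take k \<sigma>)"
      by (auto simp: permutations_of_set_def)
    then have len: "k \<le> length \<sigma>" using assms distinct_card[of \<sigma>] by simp
    have "sorted_list_of_set (set (take k \<sigma>)) = take k \<sigma>"
      using \<sigma> by (simp add: strict_sorted_iff sorted_list_of_set.idem_if_sorted_distinct)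
    then show "(case (set (take k \<sigma>), drop k \<sigma>) of (T, \<tau>) \<Rightarrow> sorted_list_of_set T @ \<tau>) = \<sigma>"
      by simp
    have split: "set (take k \<sigma>) \<union> set (drop k \<sigma>) = set \<sigma>"
      by (metis append_take_drop_id set_append)
    moreover have "set (take k \<sigma>) \<inter> set (drop k \<sigma>) = {}"
      using \<sigma> by (simp add: set_take_disj_set_drop_if_distinct)
    moreover have "card (set (take k \<sigma>)) = k"
      using \<sigma> len by (simp add: distinct_card)
    ultimately show "(set (take k \<sigma>), drop k \<sigma>) \<in> Sigma ?A (\<lambda>T. permutations_of_set (X - T))"
      using \<sigma> by (auto simp: permutations_of_set_def)
    show "(case (set (take k \<sigma>), drop k \<sigma>) of (T, \<tau>) \<Rightarrow> f \<tau>) = f (drop k \<sigma>)"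
      by simp
  next
    fix p assume "p \<in> Sigma ?A (\<lambda>T. permutations_of_set (X - T))"
    then obtain T \<tau> where p: "p = (T, \<tau>)" "T \<subseteq> X" "card T = k" "set \<tau> = X - T" "distinct \<tau>"
      by (auto simp: permutations_of_set_def)
    moreover from p assms have "finite T" using finite_subset by blast
    ultimately show
      "(set (take k (case p of (T, \<tau>) \<Rightarrow> sorted_list_of_set T @ \<tau>)),
        drop k (case p of (T, \<tau>) \<Rightarrow> sorted_list_of_set T @ \<tau>)) = p"
      "(case p of (T, \<tau>) \<Rightarrow> sorted_list_of_set T @ \<tau>)
        \<in> {\<sigma> \<in> permutations_of_set X. sorted_wrt (<) (take k \<sigma>)}"
      by (auto simp: permutations_of_set_def)
  qed
  also have "\<dots> = (\<Sum>T\<in>?A. \<Sum>\<tau>\<in>permutations_of_set (X - T). f \<tau>)"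
    using fin by (subst sum.Sigma) auto
  finally show ?thesis .
qed

text \<open>The induction runs over arbitrary finite sets, since removing a prefix from
  \<open>{1..n}\<close> does not leave an initial segment. The binomial coefficient in
  \<open>c\<close> counts the possible prefix sets.\<close>

lemma sum_perm_weight:
  fixes e c :: "nat \<Rightarrow> real"
  assumes w0: "run_weight S 0 = 1"
    and w: "\<And>l. l > 0 \<Longrightarrow> real (run_weight S l) = (\<Sum>k=1..l. e k * real (run_weight S (l - k)))"
    and c0: "c 0 = 1"
    and c: "\<And>n. n > 0 \<Longrightarrow> c n = (\<Sum>k=1..n. real (n choose k) * e k * c (n - k))"
    and "finite X"
  shows "(\<Sum>\<sigma>\<in>permutations_of_set X. real (perm_weight S \<sigma>)) = c (card X)"
  using \<open>finite X\<close>
proof (induction "card X" arbitrary: X rule: less_induct)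
  case less
  show ?case
  proof (cases "X = {}")
    case False
    with less.prems have n: "card X > 0" by (simp add: card_gt_0_iff)
    have "(\<Sum>\<sigma>\<in>permutations_of_set X. real (perm_weight S \<sigma>)) =
      (\<Sum>\<sigma>\<in>permutations_of_set X. \<Sum>k=1..card X.
         if sorted_wrt (<) (take k \<sigma>) then e k * real (perm_weight S (drop k \<sigma>)) else 0)"
    proof (rule sum.cong)
      fix \<sigma> assume "\<sigma> \<in> permutations_of_set X"
      then have "set \<sigma> = X" "distinct \<sigma>" by (auto simp: permutations_of_set_def)
      moreover from this have "length \<sigma> = card X" using distinct_card by fastforce
      ultimately show "real (perm_weight S \<sigma>) = (\<Sum>k=1..card X.
         if sorted_wrt (<) (take k \<sigma>) then e k * real (perm_weight S (drop k \<sigma>)) else 0)"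
        using perm_weight_expand[OF w0 w, of \<sigma>] False by auto
    qed simp
    also have "\<dots> = (\<Sum>k=1..card X. \<Sum>\<sigma>\<in>permutations_of_set X.
         if sorted_wrt (<) (take k \<sigma>) then e k * real (perm_weight S (drop k \<sigma>)) else 0)"
      by (rule sum.swap)
    also have "\<dots> = (\<Sum>k=1..card X. \<Sum>T | T \<subseteq> X \<and> card T = k.
        \<Sum>\<tau>\<in>permutations_of_set (X - T). e k * real (perm_weight S \<tau>))"
      using less.prems
      by (intro sum.cong refl, subst sum_permutations_increasing_prefix) auto
    \<comment> \<open>As \<open>k\<close> is at least 1, the complement of \<open>T\<close> is
      smaller than \<open>X\<close> and the induction hypothesis applies.\<close>
    also have "\<dots> = (\<Sum>k=1..card X. \<Sum>T | T \<subseteq> X \<and> card T = k. e k * c (card X - k))"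
    proof (intro sum.cong refl)
      fix k T assume "k \<in> {1..card X}" "T \<in> {T. T \<subseteq> X \<and> card T = k}"
      moreover from this have "card (X - T) = card X - k"
        using less.prems by (auto simp: card_Diff_subset finite_subset)
      ultimately show "(\<Sum>\<tau>\<in>permutations_of_set (X - T). e k * real (perm_weight S \<tau>)) =
          e k * c (card X - k)"
        using less.hyps[of "X - T"] less.prems by (simp flip: sum_distrib_left)
    qed
    also have "\<dots> = c (card X)"
      using n_subsets[OF less.prems] by (simp add: c[OF n] mult.assoc)
    finally show ?thesis .
  qed (simp add: c0)
qed

section \<open>Matching the recursions for the run weights and for the coefficients\<close>

theorem corollary3p12:
  fixes A B :: "nat set" and c :: "nat \<Rightarrow> real"
  assumes "A \<subseteq> {a. odd a}"
    and "B \<subseteq> {b. even b \<and> b > 0}"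
    and "1 \<in> A"
    and "odd_ended (A \<union> B)"
    and "inverse (1 - set_egf A + set_egf B) = Abs_fps (\<lambda>n. c n / fact n)"
  shows "\<forall>n. c n \<in> \<nat> \<and> c n = real (\<Sum>\<sigma>\<in>permutations_of_set {1..n}. perm_weight (A \<union> B) \<sigma>)"
proof -
  let ?S = "A \<union> B"
  let ?e = "signed_indicator ?S"
  let ?E = "Abs_fps (\<lambda>k. ?e k / fact k)"
  let ?F = "Abs_fps (\<lambda>n. c n / fact n)"
  have S: "1 \<in> ?S" "0 \<notin> ?S" using assms by auto
  \<comment> \<open>The link between the two sides: the signs \<open>?e\<close> that drive this
    ordinary recursion are also the numerators in the exponential series \<open>?E\<close>.\<close>
  have w: "real (run_weight ?S l) = (\<Sum>k=1..l. ?e k * real (run_weight ?S (l - k)))" if "l > 0" for l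
    using fps_nth_rec[OF run_weight_gf[OF S assms(4)] _ that] S by (simp add: signed_indicator_def)
  have "1 - set_egf A + set_egf B = 1 - ?E"
    by (rule fps_ext) (use assms(1,2) in \<open>auto simp: set_egf_def signed_indicator_def\<close>)
  with assms(5) have inv: "?F = inverse (1 - ?E)" by simp
  have "(1 - ?E) $ 0 = 1" using S by (simp add: signed_indicator_def)
  then have EF: "(1 - ?E) * ?F = 1"
    unfolding inv by (intro inverse_mult_eq_1') simp
  have "((1 - ?E) * ?F) $ 0 = 1" by (simp only: EF fps_one_nth) simp
  then have c0: "c 0 = 1" using S by (simp add: signed_indicator_def)
  \<comment> \<open>Multiplying the coefficient recursion by \<open>fact n\<close> turns the
    factorials in the denominators into a binomial coefficient.\<close>
  have c: "c n = (\<Sum>k=1..n. real (n choose k) * ?e k * c (n - k))" if "n > 0" for n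
  proof -
    have "c n / fact n = (\<Sum>k=1..n. ?e k / fact k * (c (n - k) / fact (n - k)))"
      using fps_nth_rec[OF EF _ that] S by (simp add: signed_indicator_def)
    then have "c n = fact n * (\<Sum>k=1..n. ?e k / fact k * (c (n - k) / fact (n - k)))"
      by (simp add: field_simps)
    also have "\<dots> = (\<Sum>k=1..n. real (n choose k) * ?e k * c (n - k))"
      unfolding sum_distrib_left by (intro sum.cong) (auto simp: binomial_fact)
    finally show ?thesis .
  qed
  have "c n = real (\<Sum>\<sigma>\<in>permutations_of_set {1..n}. perm_weight ?S \<sigma>)" for n
    using sum_perm_weight[OF run_weight_0 w c0 c, of "{1..n}"] by simp
  then show ?thesis by (metis of_nat_in_Nats)
qed

end
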